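(* Let $\Delta:\mathcal{U}(M)\to\mathcal{U}(N)$ be a surjective isometry between the unitary sets of two unital JB$^*$-algebras $M$ and $N$. Let $\{\mathcal{U}^0(M)\}\cup\{\mathcal{U}^j(M):j\in\Lambda\}$ be the collection of all connected components of $\mathcal{U}(M)$. For each $j\in\Lambda\cup\{0\}$, let $T_j:M\to N$ denote the surjective real linear isometry extending the mapping $\Delta|_{\mathcal{U}^j(M)}:\mathcal{U}^j(M)\to\Delta(\mathcal{U}^j(M))$. Then the following statements are equivalent: (a) $\Delta$ admits an extension to a surjective (real linear) isometry from $M$ onto $N$; (b) The extensions $T_{j_1}$ and $T_{j_2}$ coincide for all $j_1,j_2\in\Lambda\cup\{0\}$.
   Context: A complex Jordan algebra is a complex vector space $M$ with a commutative bilinear product $\circ$ satisfying $(a\circ b)\circ a^2=a\circ(b\circ a^2)$. For $a\in M$, $U_a(x)=2(a\circ x)\circ a-(a\circ a)\circ x$. A JB$^*$-algebra is a complex Jordan algebra $M$ with a complete norm satisfying $\|a\circ b\|\le\|a\|\,\|b\|$ and a conjugate linear algebra involution $*$ such that $\|U_a(a^* )\|=\|a\|^3$ for all $a\in M$. Assume $M$ has a unit $\mathbf{1}$. An element $a\in M$ is invertible if there is a (necessarily unique) $a^{-1}\in M$ with $a\circ a^{-1}=\mathbf{1}$ and $a^2\circ a^{-1}=a$ (where $a^2=a\circ a$). An element $u$ is unitary if it is invertible with $u^{-1}=u^*$; $\mathcal{U}(M)$ is the set of unitaries with the metric given by the norm, and $\mathcal{U}^0(M)$ is the connected component of $\mathcal{U}(M)$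 containing $\mathbf{1}$. The index set $\Lambda$ does not contain $0$. An isometry between metric spaces is a distance-preserving map. Known fact making the maps $T_j$ meaningful: every surjective isometry between a connected component of $\mathcal{U}(M)$ and a connected component of $\mathcal{U}(N)$ extends to a surjective real linear isometry from $M$ onto $N$; moreover $\Delta$ maps connected components of $\mathcal{U}(M)$ onto connected components of $\mathcal{U}(N)$. *)

theory Defs
  imports "HOL-Analysis.Analysis"
begin

text \<open>Complex vector spaces, as real vector spaces with a compatible complex scalar multiplication.\<close>

class complex_vector = real_vector +
  fixes scaleC :: "complex \<Rightarrow> 'a \<Rightarrow> 'a"  (infixr "*\<^sub>C" 75)
  assumes scaleC_add_right: "c *\<^sub>C (x + y) = c *\<^sub>C x + c *\<^sub>C y"
    and scaleC_add_left: "(c + d) *\<^sub>C x = c *\<^sub>C x + d *\<^sub>C x"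
    and scaleC_scaleC: "c *\<^sub>C (d *\<^sub>C x) = (c * d) *\<^sub>C x"
    and scaleC_of_real: "complex_of_real r *\<^sub>C x = r *\<^sub>R x"

text \<open>Linearity of the product in the second argument follows from commutativity.\<close>

class complex_jordan_algebra = complex_vector +
  fixes jprod :: "'a \<Rightarrow> 'a \<Rightarrow> 'a"  (infixl "\<odot>" 70)
  assumes jprod_commute: "a \<odot> b = b \<odot> a"
    and jprod_add_left: "(a + b) \<odot> c = a \<odot> c + b \<odot> c"
    and jprod_scaleC_left: "(k *\<^sub>C a) \<odot> b = k *\<^sub>C (a \<odot> b)"
    and jordan_identity: "(a \<odot> b) \<odot> (a \<odot> a) = a \<odot> (b \<odot> (a \<odot> a))"
begin

definition U_op :: "'a \<Rightarrow> 'a \<Rightarrow> 'a" where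
  "U_op a x = 2 *\<^sub>R ((a \<odot> x) \<odot> a) - (a \<odot> a) \<odot> x"

end

text \<open>Completeness of the norm comes from the class \<open>banach\<close>.\<close>

class jb_star_algebra = complex_jordan_algebra + banach +
  fixes star :: "'a \<Rightarrow> 'a"
  assumes norm_scaleC: "norm (c *\<^sub>C x) = cmod c * norm x"
    and norm_jprod_le: "norm (a \<odot> b) \<le> norm a * norm b"
    and star_add: "star (a + b) = star a + star b"
    and star_scaleC: "star (c *\<^sub>C a) = cnj c *\<^sub>C star a"
    and star_star: "star (star a) = a"
    and star_jprod: "star (a \<odot> b) = star a \<odot> star b"
    and norm_U_op_star: "norm (U_op a (star a)) = norm a ^ 3"

class unital_jb_star_algebra = jb_star_algebra + one +
  assumes jprod_one_left: "1 \<odot> a = a"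
begin

definition is_jordan_inverse :: "'a \<Rightarrow> 'a \<Rightarrow> bool" where
  "is_jordan_inverse a b \<longleftrightarrow> a \<odot> b = 1 \<and> (a \<odot> a) \<odot> b = a"

text \<open>Jordan inverses are unique, so \<open>u\<close> is unitary (invertible with inverse \<open>star u\<close>)
  precisely when \<open>star u\<close> is a Jordan inverse of \<open>u\<close>.\<close>

definition unitaries :: "'a set" where
  "unitaries = {u. is_jordan_inverse u (star u)}"

end

text \<open>Distance-preserving on the set \<open>S\<close>; surjectivity is stated separately.\<close>

definition isometry_on :: "'a::metric_space set \<Rightarrow> ('a \<Rightarrow> 'b::metric_space) \<Rightarrow> bool" where
  "isometry_on S f \<longleftrightarrow> (\<forall>x\<in>S. \<forall>y\<in>S. dist (f x) (f y) = dist x y)"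

text \<open>Here \<open>linear\<close> means real linear.\<close>

definition surj_real_linear_isometry ::
    "('a::real_normed_vector \<Rightarrow> 'b::real_normed_vector) \<Rightarrow> bool" where
  "surj_real_linear_isometry F \<longleftrightarrow> linear F \<and> isometry_on UNIV F \<and> surj F"

end

theory Submission
  imports Defs
begin

text \<open>
  For (a) implies (b) it suffices that a bounded real linear map \<open>D\<close> vanishing on one connected
  component \<open>C\<close> of the unitaries vanishes everywhere; this is applied to the difference of \<open>T j\<close>
  and the extension.  For skew-adjoint \<open>h\<close> and \<open>w \<in> C\<close> the solution of \<open>f' = h \<odot> f\<close>, \<open>f 0 = w\<close>
  is a curve in \<open>C\<close>, so differentiating \<open>D (f t) = 0\<close> at \<open>0\<close> gives \<open>D (h \<odot> w) = 0\<close>.  As \<open>C\<close> is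
  stable under multiplication by \<open>\<i>\<close>, this extends to all \<open>h\<close>.  Hence \<open>y \<mapsto> D (x \<odot> y)\<close> also
  vanishes on \<open>C\<close>, and the same argument with \<open>h = star u\<close> for some \<open>u \<in> C\<close> gives
  \<open>D x = D (x \<odot> (star u \<odot> u)) = 0\<close>.
\<close>

section \<open>Identities in Jordan algebras\<close>

lemma jprod_add_right: "a \<odot> (b + c) = a \<odot> b + a \<odot> (c::'a::complex_jordan_algebra)"
  by (metis jprod_commute jprod_add_left)

lemma jprod_scaleR_left: "(r *\<^sub>R a) \<odot> b = r *\<^sub>R (a \<odot> (b::'a::complex_jordan_algebra))"
  by (metis jprod_scaleC_left scaleC_of_real)

lemma jprod_scaleR_right: "a \<odot> (r *\<^sub>R b) = r *\<^sub>R (a \<odot> (b::'a::complex_jordan_algebra))"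
  by (metis jprod_commute jprod_scaleR_left)

lemma jprod_scaleC_right: "a \<odot> (k *\<^sub>C b) = k *\<^sub>C (a \<odot> (b::'a::complex_jordan_algebra))"
  by (metis jprod_commute jprod_scaleC_left)

lemma jprod_minus_left: "(- a) \<odot> b = - (a \<odot> (b::'a::complex_jordan_algebra))"
  using jprod_scaleR_left[of "-1"] by simp

lemma jprod_minus_right: "a \<odot> (- b) = - (a \<odot> (b::'a::complex_jordan_algebra))"
  using jprod_scaleR_right[of _ "-1"] by simp

lemma jprod_diff_left: "(a - b) \<odot> c = a \<odot> c - b \<odot> (c::'a::complex_jordan_algebra)"
  using jprod_add_left[of a "- b"] by (simp add: jprod_minus_left)

lemma jprod_diff_right: "a \<odot> (b - c) = a \<odot> b - a \<odot> (c::'a::complex_jordan_algebra)"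
  using jprod_add_right[of a b "- c"] by (simp add: jprod_minus_right)

lemma jprod_zero_right: "a \<odot> 0 = (0::'a::complex_jordan_algebra)"
  using jprod_scaleR_right[of a 0] by simp

lemmas jprod_linear = jprod_add_left jprod_add_right jprod_diff_left jprod_diff_right
  jprod_minus_left jprod_minus_right jprod_scaleR_left jprod_scaleR_right jprod_zero_right

lemma self_add_eq_iff: "x + x = y + y \<longleftrightarrow> x = (y::'a::real_vector)"
  by (metis scaleR_2 scaleR_cancel_left zero_neq_numeral)

text \<open>Inclusion-exclusion on \<open>a + b + c\<close> extracts from the cubic defect
  \<open>J\<close> its part linear in each of \<open>a\<close>, \<open>b\<close>, \<open>c\<close>.
  Every term occurs twice there, hence the halving by \<open>self_add_eq_iff\<close>.\<close>

lemma linearised_jordan_identity: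
  fixes a b c d :: "'a::complex_jordan_algebra"
  shows "(a \<odot> d) \<odot> (b \<odot> c) + (b \<odot> d) \<odot> (a \<odot> c) + (c \<odot> d) \<odot> (a \<odot> b) =
    a \<odot> (d \<odot> (b \<odot> c)) + b \<odot> (d \<odot> (a \<odot> c)) + c \<odot> (d \<odot> (a \<odot> b))"
proof -
  define J where "J x = (x \<odot> d) \<odot> (x \<odot> x) - x \<odot> (d \<odot> (x \<odot> x))" for x
  have "J x = 0" for x
    by (simp add: J_def jordan_identity)
  then have "J (a + b + c) - J (a + b) - J (b + c) - J (a + c) + J a + J b + J c = 0"
    by simp
  then show ?thesis
    unfolding J_def
    by (subst self_add_eq_iff[symmetric]) (simp add: jprod_linear jprod_commute algebra_simps)
qed

text \<open>Read as a function of \<open>c\<close>, this writes multiplication by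
  \<open>(a \<odot> b) \<odot> d\<close> through multiplications by \<open>a\<close>,
  \<open>b\<close>, \<open>d\<close> and their pairwise products.\<close>

lemma jprod_jprod_jprod:
  fixes a b c d :: "'a::complex_jordan_algebra"
  shows "((a \<odot> b) \<odot> d) \<odot> c = (a \<odot> b) \<odot> (d \<odot> c) + (b \<odot> c) \<odot> (a \<odot> d) + (a \<odot> c) \<odot> (b \<odot> d)
    - a \<odot> (d \<odot> (b \<odot> c)) - b \<odot> (d \<odot> (a \<odot> c))"
  using linearised_jordan_identity[of a d b c]
  by (simp add: jprod_commute algebra_simps)

text \<open>Exchanging \<open>a\<close> and \<open>b\<close> leaves one side of the linearised
  identity fixed, so subtracting the two instances shows that a commutator of multiplications is a
  derivation.\<close>

lemma commutator_derivation:
  fixes a b c d :: "'a::complex_jordan_algebra"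
  shows "a \<odot> (b \<odot> (c \<odot> d)) - b \<odot> (a \<odot> (c \<odot> d)) =
    (a \<odot> (b \<odot> c) - b \<odot> (a \<odot> c)) \<odot> d + c \<odot> (a \<odot> (b \<odot> d) - b \<odot> (a \<odot> d))"
  using linearised_jordan_identity[of a b d c] linearised_jordan_identity[of b a d c]
  by (simp add: jprod_linear jprod_commute algebra_simps)

text \<open>The polarised \<open>U_op\<close>: \<open>jtriple a x a = U_op a x\<close>. Without an
  involution in the middle slot it is trilinear; \<open>jtriple x (star y) z\<close> is the
  JB*-triple product.\<close>

definition jtriple :: "'a \<Rightarrow> 'a \<Rightarrow> 'a \<Rightarrow> 'a::complex_jordan_algebra" where
  "jtriple x y z = (x \<odot> y) \<odot> z + (z \<odot> y) \<odot> x - (x \<odot> z) \<odot> y"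

text \<open>If \<open>star h = - h\<close>, then
  \<open>star (h \<odot> y) = - (h \<odot> star y)\<close>, so the minus sign becomes a plus for
  \<open>jtriple x (star y) z\<close>.\<close>

lemma jprod_jtriple:
  fixes h x y z :: "'a::complex_jordan_algebra"
  shows "h \<odot> jtriple x y z = jtriple (h \<odot> x) y z - jtriple x (h \<odot> y) z + jtriple x y (h \<odot> z)"
  using commutator_derivation[of x y h z] linearised_jordan_identity[of h z x y]
  unfolding jtriple_def
  by (simp add: jprod_linear jprod_commute algebra_simps)

section \<open>Multiplication operators of an invertible element and its inverse\<close>

definition jcommutator :: "'a \<Rightarrow> 'a \<Rightarrow> 'a \<Rightarrow> 'a::complex_jordan_algebra" where
  "jcommutator a b z = a \<odot> (b \<odot> z) - b \<odot> (a \<odot> z)"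

lemma jcommutator_swap: "jcommutator b a z = - jcommutator a b z"
  by (simp add: jcommutator_def)

lemma jcommutator_linear:
  "jcommutator a b (x - y) = jcommutator a b x - jcommutator a b y"
  "jcommutator a b (- x) = - jcommutator a b x"
  "jcommutator a b (r *\<^sub>R x) = r *\<^sub>R jcommutator a b x"
  by (simp_all add: jcommutator_def jprod_linear algebra_simps)

lemma jprod_one_right: "x \<odot> 1 = (x::'a::unital_jb_star_algebra)"
  by (metis jprod_commute jprod_one_left)

text \<open>With both directions assumed, every result may be reused with \<open>u\<close> and
  \<open>v\<close> exchanged. For unitaries the second direction comes from applying
  \<open>star\<close> to the first.\<close>

locale jordan_inverse_pair =
  fixes u v :: "'a::unital_jb_star_algebra"
  assumes inverse: "is_jordan_inverse u v" and inverse_sym: "is_jordan_inverse v u"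
begin

lemma products: "u \<odot> v = 1" "v \<odot> u = 1" "(u \<odot> u) \<odot> v = u" "(v \<odot> v) \<odot> u = v"
  "v \<odot> (u \<odot> u) = u" "u \<odot> (v \<odot> v) = v"
  using inverse inverse_sym by (auto simp: is_jordan_inverse_def jprod_commute)

lemma square_commutes_inverse: "(u \<odot> u) \<odot> (v \<odot> z) = v \<odot> ((u \<odot> u) \<odot> z)"
  using linearised_jordan_identity[of u z u v]
  by (simp add: products jprod_one_right jprod_one_left jprod_commute algebra_simps)

lemma square_inverse: "(u \<odot> u) \<odot> (v \<odot> z) = 2 *\<^sub>R (u \<odot> (v \<odot> (u \<odot> z))) - u \<odot> z"
  using jprod_jprod_jprod[of u u v z]
  by (simp add: products jprod_one_right jprod_one_left scaleR_2 algebra_simps)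

text \<open>Two expressions for \<open>(u \<odot> u) \<odot> (v \<odot> z)\<close> are compared:
  \<open>square_inverse\<close>, and the operator identity expanded at
  \<open>(u \<odot> v) \<odot> u = u\<close>.\<close>

lemma jcommutator_jprod: "jcommutator u v (u \<odot> z) = u \<odot> jcommutator u v z"
  using jprod_jprod_jprod[of u v u z] square_inverse[of z]
  by (simp add: jcommutator_def products jprod_one_right jprod_one_left jprod_linear scaleR_2
      jprod_commute algebra_simps)

lemma square_jcommutator: "(u \<odot> u) \<odot> jcommutator u v z = 2 *\<^sub>R (u \<odot> (u \<odot> jcommutator u v z))"
proof -
  have "(u \<odot> u) \<odot> (u \<odot> y) = u \<odot> ((u \<odot> u) \<odot> y)" for y
    by (metis jordan_identity jprod_commute)
  then have "(u \<odot> u) \<odot> jcommutator u v z = 2 *\<^sub>R (u \<odot> jcommutator u v (u \<odot> z))"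
    by (simp add: jcommutator_def square_inverse jprod_linear algebra_simps)
  then show ?thesis by (simp add: jcommutator_jprod)
qed

text \<open>On the range of the commutator, \<open>(u \<odot> u) \<odot> (v \<odot> x)\<close> is
  computed in two ways: by moving \<open>v\<close> outside and by
  \<open>square_inverse\<close>.\<close>

lemma jprod_jcommutator:
  "u \<odot> jcommutator u v z = 2 *\<^sub>R jcommutator u v (jcommutator u v (u \<odot> z))"
proof -
  define x where "x = jcommutator u v z"
  have "(u \<odot> u) \<odot> (v \<odot> x) = 2 *\<^sub>R (v \<odot> (u \<odot> (u \<odot> x)))"
    by (simp add: x_def square_commutes_inverse square_jcommutator jprod_scaleR_right)
  with square_inverse[of x] have "u \<odot> x = 2 *\<^sub>R jcommutator u v (u \<odot> x)"
    by (simp add: jcommutator_def algebra_simps)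
  then show ?thesis by (simp only: x_def flip: jcommutator_jprod)
qed

end

lemma jordan_inverse_pair_sym: "jordan_inverse_pair u v \<Longrightarrow> jordan_inverse_pair v u"
  by (simp add: jordan_inverse_pair_def)

text \<open>The inner commutator is expanded into its two terms; since the commutator commutes with
  both multiplications, \<open>jprod_jcommutator\<close> applies to each.\<close>

lemma (in jordan_inverse_pair) jcommutator_square:
  "jcommutator u v (jcommutator u v z) =
    2 *\<^sub>R jcommutator u v (jcommutator u v (jcommutator u v z))"
proof -
  interpret sym: jordan_inverse_pair v u
    by (rule jordan_inverse_pair_sym) unfold_locales
  let ?X = "jcommutator u v"
  have v_X: "?X (v \<odot> y) = v \<odot> ?X y" for y
    using sym.jcommutator_jprod[of y] by (simp add: jcommutator_swap[of v u] jprod_minus_right)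
  have "?X (?X z) = ?X (u \<odot> (v \<odot> z)) - ?X (v \<odot> (u \<odot> z))"
    by (subst (2) jcommutator_def) (simp add: jcommutator_linear)
  also have "\<dots> = u \<odot> ?X (v \<odot> z) - v \<odot> (u \<odot> ?X z)"
    by (simp add: v_X jcommutator_jprod)
  also have "u \<odot> ?X (v \<odot> z) = 2 *\<^sub>R ?X (?X (u \<odot> (v \<odot> z)))"
    by (rule jprod_jcommutator)
  also have "v \<odot> (u \<odot> ?X z) = 2 *\<^sub>R ?X (?X (v \<odot> (u \<odot> z)))"
    by (simp add: jprod_jcommutator[of z] v_X jprod_scaleR_right)
  also have "2 *\<^sub>R ?X (?X (u \<odot> (v \<odot> z))) - 2 *\<^sub>R ?X (?X (v \<odot> (u \<odot> z))) =
      2 *\<^sub>R ?X (?X (u \<odot> (v \<odot> z) - v \<odot> (u \<odot> z)))"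
    by (simp only: jcommutator_linear scaleR_diff_right)
  also have "u \<odot> (v \<odot> z) - v \<odot> (u \<odot> z) = ?X z"
    by (simp add: jcommutator_def)
  finally show ?thesis .
qed

text \<open>Write \<open>X\<close> for the commutator of the multiplications by \<open>u\<close> and \<open>v\<close>.  The relation
  \<open>X\<^sup>2 = 2 X\<^sup>3\<close> for the pair \<open>(v, u)\<close> reads \<open>X\<^sup>2 = - 2 X\<^sup>3\<close>, so \<open>X\<^sup>2 = 0\<close>.  Then \<open>u\<close>, \<open>v\<close> and
  \<open>u \<odot> u\<close> annihilate the range of \<open>X\<close>, but \<open>((u \<odot> u) \<odot> v) \<odot> v = 1\<close>.\<close>

lemma (in jordan_inverse_pair) jcommutator_eq_0: "jcommutator u v z = 0"
proof -
  interpret sym: jordan_inverse_pair v u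
    by (rule jordan_inverse_pair_sym) unfold_locales
  let ?X = "jcommutator u v"
  have "?X (?X y) = - (2 *\<^sub>R ?X (?X (?X y)))" for y
    using sym.jcommutator_square[of y] by (simp add: jcommutator_swap[of v u] jcommutator_linear)
  then have "?X (?X y) + ?X (?X y) = 0 + 0" for y
    using jcommutator_square[of y] by (metis add.right_inverse add_0)
  then have XX: "?X (?X y) = 0" for y
    by (simp only: self_add_eq_iff)
  have uX: "u \<odot> ?X y = 0" for y
    using jprod_jcommutator[of y] by (simp add: XX)
  have vX: "v \<odot> ?X y = 0" for y
    using sym.jprod_jcommutator[of y]
    by (simp add: XX jcommutator_swap[of v u] jcommutator_linear jprod_minus_right)
  have u2X: "(u \<odot> u) \<odot> ?X y = 0" for y
    using square_jcommutator[of y] by (simp add: uX jprod_zero_right)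
  show ?thesis
    using jprod_jprod_jprod[of "u \<odot> u" v v "?X z"]
    by (simp add: products jprod_one_left uX vX u2X jprod_zero_right jprod_commute[of 0])
qed

text \<open>The triple product equals \<open>z + jcommutator u v z\<close>; this is why the
  commutator has to vanish.\<close>

lemma (in jordan_inverse_pair) jtriple_inverse: "jtriple u v z = z"
  using jcommutator_eq_0[of z]
  by (simp add: jcommutator_def jtriple_def products jprod_one_left jprod_commute)

text \<open>The instances \<open>z = 1\<close> and \<open>z = u\<close> give the two defining
  equations.\<close>

lemma jordan_inverse_if_jtriple:
  fixes u v :: "'a::unital_jb_star_algebra"
  assumes "\<And>z. jtriple u v z = z"
  shows "is_jordan_inverse u v"
proof -
  have "u \<odot> v = 1"
    using assms[of 1] by (simp add: jtriple_def jprod_one_left jprod_commute)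
  moreover from this have "(u \<odot> u) \<odot> v = u"
    using assms[of u] by (simp add: jtriple_def jprod_one_left jprod_commute algebra_simps)
  ultimately show ?thesis by (simp add: is_jordan_inverse_def)
qed

section \<open>Linear differential equations in Banach spaces\<close>

text \<open>Around a zero, on an interval of radius \<open>1 / (2 * K)\<close>, the mean value
  inequality bounds the maximum of \<open>norm (g t)\<close> by half of itself.\<close>

lemma linear_ode_unique:
  fixes g :: "real \<Rightarrow> 'a::real_normed_vector"
  assumes A: "bounded_linear A"
    and g: "\<And>t. (g has_vector_derivative A (g t)) (at t)"
    and "g s = 0"
  shows "g t = 0"
proof -
  obtain K where K: "K > 0" "\<And>x. norm (A x) \<le> norm x * K"
    using bounded_linear.pos_bounded[OF A] by blast
  have cont: "continuous_on UNIV g"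
    using g by (auto intro!: has_vector_derivative_continuous continuous_at_imp_continuous_on)
  have local: "g y = 0" if "g x = 0" "y \<in> cball x (1 / (2 * K))" for x y
  proof -
    let ?S = "cball x (1 / (2 * K))"
    have "continuous_on ?S (\<lambda>t. norm (g t))"
      using cont by (auto intro!: continuous_intros intro: continuous_on_subset)
    moreover have "x \<in> ?S"
      using K by simp
    ultimately obtain m where m: "m \<in> ?S" "\<And>t. t \<in> ?S \<Longrightarrow> norm (g t) \<le> norm (g m)"
      using continuous_attains_sup[of ?S "\<lambda>t. norm (g t)"] by (auto simp del: mem_cball)
    have "norm (g m - g x) \<le> (K * norm (g m)) * norm (m - x)"
    proof (rule differentiable_bound[of ?S g "\<lambda>t h. h *\<^sub>R A (g t)"])
      show "convex ?S" by simp
      show "(g has_derivative (\<lambda>h. h *\<^sub>R A (g t))) (at t within ?S)" for t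
        using g[of t] by (simp add: has_vector_derivative_def has_derivative_at_withinI)
      show "onorm (\<lambda>h. h *\<^sub>R A (g t)) \<le> K * norm (g m)" if "t \<in> ?S" for t
      proof (rule onorm_le)
        fix h :: real
        have "norm (A (g t)) \<le> K * norm (g m)"
          using order_trans[OF K(2)[of "g t"] mult_right_mono[OF m(2)[OF that], of K]] K(1)
          by (simp add: mult.commute)
        then show "norm (h *\<^sub>R A (g t)) \<le> K * norm (g m) * norm h"
          by (simp add: mult.commute mult_left_mono)
      qed
    qed (use m that K in auto)
    also have "\<dots> \<le> (K * norm (g m)) * (1 / (2 * K))"
      using m(1) K by (intro mult_left_mono) (auto simp: dist_norm norm_minus_commute)
    also have "\<dots> = norm (g m) / 2"
      using K by simp
    finally have "norm (g m) = 0"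
      using that by simp
    then show ?thesis
      using m(2)[OF that(2)] by simp
  qed
  \<comment> \<open>The radius does not depend on the zero, so the zero set is open as well as
    closed, and the line is connected.\<close>
  let ?Z = "{x. g x = 0}"
  have "closed ?Z"
    by (intro closed_Collect_eq cont continuous_on_const)
  moreover have "open ?Z"
    unfolding open_contains_cball
    using local K(1) by (intro ballI exI[of _ "1 / (2 * K)"]) (auto simp del: mem_cball)
  ultimately have "?Z = {} \<or> ?Z = UNIV"
    using clopen[of ?Z] by simp
  moreover have "s \<in> ?Z"
    using \<open>g s = 0\<close> by simp
  ultimately have "t \<in> ?Z"
    by auto
  then show ?thesis by simp
qed

text \<open>The solution is the exponential series of \<open>t A\<close> applied to
  \<open>x\<close>, differentiated term by term.\<close>

lemma linear_ode_exists:
  fixes A :: "'a::banach \<Rightarrow> 'a"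
  assumes A: "bounded_linear A"
  obtains g where "g 0 = x" "\<And>t. (g has_vector_derivative A (g t)) (at t)"
proof -
  obtain K where K: "K > 0" "\<And>x. norm (A x) \<le> norm x * K"
    using bounded_linear.pos_bounded[OF A] by blast
  interpret A: bounded_linear A by fact
  define f where "f n t = (t ^ n / fact n) *\<^sub>R (A ^^ n) x" for n and t :: real
  \<comment> \<open>At \<open>n = 0\<close> the truncated exponent \<open>n - 1\<close> is harmless,
    because the factor \<open>of_nat n\<close> is zero.\<close>
  define f' where "f' n t = (of_nat n * t ^ (n - 1) / fact n) *\<^sub>R (A ^^ n) x" for n and t :: real
  define g where "g t = (\<Sum>n. f n t)" for t
  have iter: "norm ((A ^^ n) x) \<le> norm x * K ^ n" for n
  proof (induction n)
    case (Suc n)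
    have "norm ((A ^^ Suc n) x) \<le> norm ((A ^^ n) x) * K"
      using K(2) by simp
    also have "\<dots> \<le> norm x * K ^ n * K"
      using Suc K(1) by (intro mult_right_mono) auto
    finally show ?case by (simp add: mult_ac)
  qed simp
  have f_bound: "norm (f n t) \<le> norm x * ((R * K) ^ n / fact n)" if "\<bar>t\<bar> \<le> R" for n t R
  proof -
    have "norm (f n t) = \<bar>t\<bar> ^ n / fact n * norm ((A ^^ n) x)"
      by (simp add: f_def power_abs)
    also have "\<dots> \<le> R ^ n / fact n * (norm x * K ^ n)"
      using that iter by (intro mult_mono divide_right_mono power_mono) auto
    finally show ?thesis
      by (simp add: power_mult_distrib mult_ac)
  qed
  have sum_bound: "summable (\<lambda>n. norm x * ((R * K) ^ n / fact n))" for R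
    using summable_exp[of "R * K"] by (intro summable_mult) (simp add: divide_inverse mult.commute)
  have summable_f: "summable (\<lambda>n. f n t)" for t
    by (rule summable_comparison_test'[OF sum_bound[of "\<bar>t\<bar>"]]) (use f_bound in auto)
  have f'_Suc: "f' (Suc n) t = A (f n t)" for n t
  proof -
    have "real (Suc n) / fact (Suc n) = 1 / fact n"
      by (simp add: fact_Suc del: of_nat_Suc)
    then have "real (Suc n) * t ^ n / fact (Suc n) = t ^ n / fact n"
      by (metis mult.commute mult_1 times_divide_eq_left)
    then show ?thesis by (simp add: f'_def f_def A.scaleR del: fact_Suc of_nat_Suc)
  qed
  have f'_0: "f' 0 t = 0" for t
    by (simp add: f'_def)
  have "(g has_vector_derivative A (g t)) (at t)" for t
  proof -
    \<comment> \<open>The series converges uniformly only on bounded intervals, so one containing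
      \<open>t\<close> is fixed.\<close>
    define R where "R = \<bar>t\<bar> + 1"
    have unif: "uniform_limit {-R<..<R} (\<lambda>n t. \<Sum>i<n. A (f i t)) (\<lambda>t. A (g t)) sequentially"
    proof -
      have "uniform_limit {-R<..<R} (\<lambda>n t. \<Sum>i<n. f i t) g sequentially"
        unfolding g_def by (rule Weierstrass_m_test[OF _ sum_bound[of R]]) (use f_bound in auto)
      then have "uniform_limit {-R<..<R} (\<lambda>n t. A (\<Sum>i<n. f i t)) (\<lambda>t. A (g t)) sequentially"
        by (rule bounded_linear.uniform_limit[OF A])
      then show ?thesis by (simp add: A.sum)
    qed
    have "\<exists>G. \<forall>t\<in>{-R<..<R}. (\<lambda>n. f n t) sums G t \<and>
        (G has_derivative (\<lambda>h. h *\<^sub>R A (g t))) (at t within {-R<..<R})"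
    proof (rule has_derivative_series[where x = 0 and l = "g 0" and f' = "\<lambda>n t h. h *\<^sub>R f' n t"])
      show "convex {-R<..<R}" by simp
      show "(f n has_derivative (\<lambda>h. h *\<^sub>R f' n t)) (at t within {-R<..<R})" for n t
        unfolding f_def f'_def
        by (auto intro!: derivative_eq_intros simp: fun_eq_iff)
      show "0 \<in> {-R<..<R}" by (auto simp: R_def)
      show "(\<lambda>n. f n 0) sums g 0"
        unfolding g_def by (intro summable_sums summable_f)
      fix e :: real assume "e > 0"
      then have "\<forall>\<^sub>F n in sequentially. \<forall>t\<in>{-R<..<R}. dist (\<Sum>i<n. A (f i t)) (A (g t)) < e"
        using unif by (simp add: uniform_limit_iff)
      \<comment> \<open>The term \<open>f' 0\<close> vanishes, so partial sums of derivatives are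
        those of \<open>A (f i t)\<close> with the index shifted by one.\<close>
      then have "\<forall>\<^sub>F n in sequentially. \<forall>t\<in>{-R<..<R}. dist (\<Sum>i<Suc n. f' i t) (A (g t)) < e"
        by (simp add: sum.lessThan_Suc_shift f'_Suc f'_0 del: sum.lessThan_Suc)
      then have *: "\<forall>\<^sub>F n in sequentially. \<forall>t\<in>{-R<..<R}. dist (\<Sum>i<n. f' i t) (A (g t)) < e"
        by (rule eventually_sequentially_Suc[THEN iffD1])
      show "\<forall>\<^sub>F n in sequentially. \<forall>t\<in>{-R<..<R}. \<forall>h.
          norm ((\<Sum>i<n. h *\<^sub>R f' i t) - h *\<^sub>R A (g t)) \<le> e * norm h"
        using *
      proof eventually_elim
        case (elim n)
        show ?case
        proof (intro ballI allI)
          fix t h assume "t \<in> {-R<..<R}"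
          then have "norm ((\<Sum>i<n. f' i t) - A (g t)) \<le> e"
            using elim by (auto simp: dist_norm less_imp_le)
          then have "\<bar>h\<bar> * norm ((\<Sum>i<n. f' i t) - A (g t)) \<le> \<bar>h\<bar> * e"
            by (intro mult_left_mono) auto
          then show "norm ((\<Sum>i<n. h *\<^sub>R f' i t) - h *\<^sub>R A (g t)) \<le> e * norm h"
            by (simp flip: scaleR_sum_right scaleR_diff_right add: mult.commute)
        qed
      qed
    qed
    then obtain G where G: "\<And>t. t \<in> {-R<..<R} \<Longrightarrow> (\<lambda>n. f n t) sums G t"
      "\<And>t. t \<in> {-R<..<R} \<Longrightarrow> (G has_derivative (\<lambda>h. h *\<^sub>R A (g t))) (at t within {-R<..<R})"
      by blast
    have t: "t \<in> {-R<..<R}" by (auto simp: R_def)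
    have Gg: "G s = g s" if "s \<in> {-R<..<R}" for s
      using G(1)[OF that] by (simp add: g_def sums_iff)
    have "(G has_derivative (\<lambda>h. h *\<^sub>R A (g t))) (at t)"
      using G(2)[OF t] t by (simp add: at_within_open[OF t])
    then have "(g has_derivative (\<lambda>h. h *\<^sub>R A (g t))) (at t)"
      by (rule has_derivative_transform_within_open[OF _ _ t]) (use Gg in auto)
    then show ?thesis by (simp add: has_vector_derivative_def)
  qed
  moreover have "g 0 = x"
  proof -
    have "(\<lambda>n. f n 0) sums (\<Sum>n\<in>{0}. f n 0)"
      by (rule sums_finite) (auto simp: f_def)
    then show ?thesis by (simp add: g_def sums_iff f_def)
  qed
  ultimately show ?thesis using that by blast
qed

section \<open>Connected components of the unitary set\<close>

lemma scaleC_1: "1 *\<^sub>C x = (x::'a::complex_vector)"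
  using scaleC_of_real[of 1 x] by simp

lemma scaleC_minus_1: "(- 1) *\<^sub>C x = - (x::'a::complex_vector)"
  using scaleC_of_real[of "-1" x] by simp

section \<open>Continuity of the involution and of the product\<close>

lemma star_scaleR: "star (r *\<^sub>R a) = r *\<^sub>R star (a::'a::jb_star_algebra)"
  using star_scaleC[of "complex_of_real r" a] by (simp add: scaleC_of_real)

lemma star_minus: "star (- a) = - star (a::'a::jb_star_algebra)"
  using star_scaleR[of "-1" a] by simp

lemma star_diff: "star (a - b) = star a - star (b::'a::jb_star_algebra)"
  using star_add[of a "- b"] by (simp add: star_minus)

interpretation jprod: bounded_bilinear "jprod :: 'a::jb_star_algebra \<Rightarrow> 'a \<Rightarrow> 'a"
  by standard
     (auto simp: jprod_linear intro!: exI[of _ 1] norm_jprod_le)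

lemma norm_U_op_le: "norm (U_op a x) \<le> 3 * norm a ^ 2 * norm (x::'a::jb_star_algebra)"
proof -
  have "norm ((a \<odot> x) \<odot> a) \<le> norm a * norm x * norm a"
    using norm_jprod_le[of "a \<odot> x" a] mult_right_mono[OF norm_jprod_le[of a x] norm_ge_zero[of a]]
    by linarith
  moreover have "norm ((a \<odot> a) \<odot> x) \<le> norm a * norm a * norm x"
    using norm_jprod_le[of "a \<odot> a" x] mult_right_mono[OF norm_jprod_le[of a a] norm_ge_zero[of x]]
    by linarith
  moreover have "norm (U_op a x) \<le> 2 * norm ((a \<odot> x) \<odot> a) + norm ((a \<odot> a) \<odot> x)"
    using norm_triangle_ineq4[of "2 *\<^sub>R ((a \<odot> x) \<odot> a)" "(a \<odot> a) \<odot> x"] by (simp add: U_op_def)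
  ultimately show ?thesis
    by (simp add: power2_eq_square mult_ac)
qed

text \<open>Cancel \<open>norm a ^ 2\<close> between the norm axiom for
  \<open>U_op a (star a)\<close> and the crude bound on \<open>U_op\<close>; the factor 3 is enough
  for continuity of \<open>star\<close>.\<close>

lemma norm_le_star: "norm a \<le> 3 * norm (star (a::'a::jb_star_algebra))"
proof (cases "a = 0")
  case False
  have "norm a ^ 2 * norm a \<le> norm a ^ 2 * (3 * norm (star a))"
    using norm_U_op_le[of a "star a"] norm_U_op_star[of a]
    by (simp add: power2_eq_square power3_eq_cube mult_ac)
  then show ?thesis
    using False by simp
qed simp

lemma bounded_linear_star: "bounded_linear (star :: 'a::jb_star_algebra \<Rightarrow> 'a)"
proof (rule bounded_linear_intro)
  show "norm (star x) \<le> norm x * 3" for x :: 'a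
    using norm_le_star[of "star x"] by (simp add: star_star mult.commute)
qed (simp_all add: star_add star_scaleR)

lemma unitary_inverse_pair:
  fixes u :: "'a::unital_jb_star_algebra"
  assumes "u \<in> unitaries"
  shows "jordan_inverse_pair u (star u)"
proof
  have u: "u \<odot> star u = 1" "(u \<odot> u) \<odot> star u = u"
    using assms by (auto simp: unitaries_def is_jordan_inverse_def)
  then show "is_jordan_inverse u (star u)"
    by (simp add: is_jordan_inverse_def)
  have "(star u \<odot> star u) \<odot> u = star ((u \<odot> u) \<odot> star u)"
    by (simp add: star_jprod star_star)
  with u show "is_jordan_inverse (star u) u"
    by (simp add: is_jordan_inverse_def jprod_commute)
qed

lemma unitary_scaleC:
  fixes u :: "'a::unital_jb_star_algebra"
  assumes "u \<in> unitaries" "cmod c = 1"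
  shows "c *\<^sub>C u \<in> unitaries"
proof -
  have [simp]: "c * cnj c = 1" "cnj c * c = 1" "cnj c * (c * d) = d" for d
    using assms(2) complex_norm_square[of c] by (simp_all add: mult.commute flip: mult.assoc)
  show ?thesis
    using assms(1)
    by (simp add: unitaries_def is_jordan_inverse_def star_scaleC jprod_scaleC_left
        jprod_scaleC_right scaleC_scaleC scaleC_1)
qed

text \<open>Multiplication by a skew-adjoint \<open>h\<close> acts on the triple products \<open>{x, star y, z}\<close> as a
  derivation, so its flow preserves the condition \<open>{u, star u, z} = z\<close> for all \<open>z\<close>, which
  characterises unitarity.\<close>

lemma unitary_flow:
  fixes f :: "real \<Rightarrow> 'a::unital_jb_star_algebra"
  assumes "f 0 \<in> unitaries" and h: "star h = - h"
    and f: "\<And>t. (f has_vector_derivative h \<odot> f t) (at t)"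
  shows "f t \<in> unitaries"
proof -
  have y: "((\<lambda>s. star (f s)) has_vector_derivative - (h \<odot> star (f s))) (at s)" for s
    using bounded_linear.has_vector_derivative[OF bounded_linear_star f[of s]] by (simp add: star_jprod h jprod_minus_left)
  have "jtriple (f t) (star (f t)) z = z" for z
  proof -
    obtain g\<^sub>0 where g\<^sub>0: "g\<^sub>0 0 = z" "\<And>s. (g\<^sub>0 has_vector_derivative h \<odot> g\<^sub>0 s) (at s)"
      using linear_ode_exists[OF jprod.bounded_linear_right] by blast
    \<comment> \<open>The time shift makes \<open>g t = z\<close>, so the triple identity at time
      \<open>t\<close> is tested on the given \<open>z\<close>.\<close>
    define g where "g s = g\<^sub>0 (s - t)" for s
    have g: "(g has_vector_derivative h \<odot> g s) (at s)" for s
    proof -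
      have "((\<lambda>s. s - t) has_vector_derivative 1) (at s)"
        by (auto intro!: derivative_eq_intros)
      from vector_diff_chain_at[OF this g\<^sub>0(2)] show ?thesis
        by (simp add: g_def[abs_def] o_def)
    qed
    \<comment> \<open>The defect \<open>q\<close> solves the same linear equation and vanishes at
      \<open>0\<close>, where unitarity is known.\<close>
    define q where "q s = jtriple (f s) (star (f s)) (g s) - g s" for s
    have "(q has_vector_derivative h \<odot> q s) (at s)" for s
      unfolding q_def jprod_diff_right jprod_jtriple unfolding jtriple_def
      by (rule has_vector_derivative_eq_rhs,
          (rule has_vector_derivative_add has_vector_derivative_diff jprod.has_vector_derivative f g y)+)
         (simp add: jprod_linear algebra_simps)
    moreover have "q 0 = 0"
      using jordan_inverse_pair.jtriple_inverse[OF unitary_inverse_pair[OF assms(1)]]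
      by (simp add: q_def)
    ultimately have "q t = 0"
      by (rule linear_ode_unique[OF jprod.bounded_linear_right])
    then show ?thesis
      by (simp add: q_def g_def g\<^sub>0(1))
  qed
  then show ?thesis
    unfolding unitaries_def by (simp add: jordan_inverse_if_jtriple)
qed

text \<open>The circle of multiples \<open>cis s *\<^sub>C w\<close> consists of unitaries and joins
  \<open>w\<close> to \<open>\<i> *\<^sub>C w\<close>.\<close>

lemma component_scaleC_ii:
  fixes u :: "'a::unital_jb_star_algebra"
  assumes "w \<in> connected_component_set unitaries u"
  shows "\<i> *\<^sub>C w \<in> connected_component_set unitaries u"
proof -
  let ?c = "\<lambda>s. cis s *\<^sub>C w"
  have w: "w \<in> unitaries"
    using assms connected_component_subset by blast
  have c: "?c s = cos s *\<^sub>R w + sin s *\<^sub>R (\<i> *\<^sub>C w)" for s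
  proof -
    have "cis s = complex_of_real (cos s) + complex_of_real (sin s) * \<i>"
      by (simp add: complex_eq_iff)
    then show ?thesis
      by (simp add: scaleC_add_left scaleC_of_real flip: scaleC_scaleC)
  qed
  have "continuous_on UNIV ?c"
    unfolding c by (intro continuous_intros)
  then have "connected (range ?c)"
    by (rule connected_continuous_image) simp
  moreover have "w = ?c 0" "\<i> *\<^sub>C w = ?c (pi / 2)"
    by (simp_all add: scaleC_1)
  moreover have "range ?c \<subseteq> unitaries"
    using w by (auto intro: unitary_scaleC)
  ultimately have "\<i> *\<^sub>C w \<in> connected_component_set unitaries w"
    using connected_component_maximal[of w "range ?c" unitaries] by blast
  then show ?thesis
    using connected_component_eq[OF assms] by simp
qed

section \<open>Bounded real linear maps vanishing on a component\<close>

lemma vanishes_on_component_jprod_skew: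
  fixes D :: "'a::unital_jb_star_algebra \<Rightarrow> 'b::real_normed_vector"
  assumes D: "bounded_linear D"
    and zero: "\<And>w. w \<in> connected_component_set unitaries u \<Longrightarrow> D w = 0"
    and w: "w \<in> connected_component_set unitaries u"
    and h: "star h = - h"
  shows "D (h \<odot> w) = 0"
proof -
  obtain f where f: "f 0 = w" "\<And>t. (f has_vector_derivative h \<odot> f t) (at t)"
    using linear_ode_exists[OF jprod.bounded_linear_right] by blast
  have "w \<in> unitaries"
    using w connected_component_subset by blast
  then have "range f \<subseteq> unitaries"
    using unitary_flow[of f h] f h by auto
  moreover have "connected (range f)"
    using f(2) by (intro connected_continuous_image continuous_at_imp_continuous_on)
      (auto intro: has_vector_derivative_continuous)
  moreover have "w \<in> range f"
    using f(1) by blast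
  ultimately have "range f \<subseteq> connected_component_set unitaries u"
    using connected_component_maximal connected_component_eq[OF w] by metis
  then have "(\<lambda>t. D (f t)) = (\<lambda>t. 0)"
    using zero by auto
  moreover have "((\<lambda>t. D (f t)) has_vector_derivative D (h \<odot> f 0)) (at 0)"
    by (rule bounded_linear.has_vector_derivative[OF D f(2)])
  ultimately have "((\<lambda>t. 0) has_vector_derivative D (h \<odot> w)) (at (0::real))"
    by (simp add: f(1))
  then show ?thesis
    using vector_derivative_unique_at has_vector_derivative_const by blast
qed

lemma vanishes_on_component_jprod:
  fixes D :: "'a::unital_jb_star_algebra \<Rightarrow> 'b::real_normed_vector"
  assumes D: "bounded_linear D"
    and zero: "\<And>w. w \<in> connected_component_set unitaries u \<Longrightarrow> D w = 0"
    and w: "w \<in> connected_component_set unitaries u"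
  shows "D (h \<odot> w) = 0"
proof -
  \<comment> \<open>The self-adjoint part of \<open>h\<close> is made skew-adjoint by moving a factor \<open>\<i>\<close> to \<open>w\<close>,
    which stays in the component.\<close>
  interpret D: bounded_linear D by fact
  define k where "k = (- \<i>) *\<^sub>C (h + star h)"
  have "star (h - star h) = - (h - star h)"
    by (simp add: star_diff star_star)
  then have skew: "D ((h - star h) \<odot> w) = 0"
    by (intro vanishes_on_component_jprod_skew[OF D zero w])
  have "star k = (- 1) *\<^sub>C k"
    by (simp add: k_def star_scaleC star_add star_star scaleC_scaleC add.commute)
  then have "star k = - k"
    by (simp add: scaleC_minus_1)
  then have "D (k \<odot> (\<i> *\<^sub>C w)) = 0"
    by (intro vanishes_on_component_jprod_skew[OF D zero component_scaleC_ii[OF w]])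
  also have "k \<odot> (\<i> *\<^sub>C w) = (h + star h) \<odot> w"
    by (simp add: k_def jprod_scaleC_left jprod_scaleC_right scaleC_scaleC scaleC_1)
  finally have "D ((h - star h) \<odot> w + (h + star h) \<odot> w) = 0"
    using skew by (simp add: D.add)
  also have "(h - star h) \<odot> w + (h + star h) \<odot> w = 2 *\<^sub>R (h \<odot> w)"
    by (simp add: jprod_linear scaleR_2)
  finally show ?thesis
    by (simp add: D.scaleR)
qed

lemma vanishes_on_component:
  fixes D :: "'a::unital_jb_star_algebra \<Rightarrow> 'b::real_normed_vector"
  assumes D: "bounded_linear D" and u: "u \<in> unitaries"
    and zero: "\<And>w. w \<in> connected_component_set unitaries u \<Longrightarrow> D w = 0"
  shows "D x = 0"
proof -
  have u_mem: "u \<in> connected_component_set unitaries u"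
    using u by simp
  \<comment> \<open>\<open>vanishes_on_component_jprod\<close> is applied to \<open>D\<close> and then to \<open>\<lambda>y. D (x \<odot> y)\<close>, because
    the kernel of \<open>D\<close> is not known to be an ideal.\<close>
  have "bounded_linear (\<lambda>y. D (x \<odot> y))"
    by (rule bounded_linear_compose[OF D jprod.bounded_linear_right])
  then have "D (x \<odot> (star u \<odot> u)) = 0"
    by (rule vanishes_on_component_jprod[OF _ vanishes_on_component_jprod[OF D zero] u_mem])
  moreover have "star u \<odot> u = 1"
    using u by (simp add: unitaries_def is_jordan_inverse_def jprod_commute)
  ultimately show ?thesis
    by (simp add: jprod_one_right)
qed

lemma surj_real_linear_isometry_bounded_linear:
  assumes "surj_real_linear_isometry F"
  shows "bounded_linear F"
proof -
  interpret linear F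
    using assms by (simp add: surj_real_linear_isometry_def)
  have "norm (F x) = norm x" for x
    using assms by (metis UNIV_I dist_0_norm dist_commute isometry_on_def
        surj_real_linear_isometry_def zero)
  then show ?thesis
    by (intro bounded_linear_intro[of _ 1]) (simp_all add: add scale)
qed

theorem corollary3p11:
  fixes \<Delta> :: "'a::unital_jb_star_algebra \<Rightarrow> 'b::unital_jb_star_algebra"
    and \<Lambda> :: "'i::zero set"
    and \<U> :: "'i \<Rightarrow> 'a set"
    and T :: "'i \<Rightarrow> 'a \<Rightarrow> 'b"
  assumes "isometry_on unitaries \<Delta>"
    and "\<Delta> ` unitaries = unitaries"
    and "0 \<notin> \<Lambda>"
    and "\<U> 0 = connected_component_set unitaries 1"
    and "{\<U> 0} \<union> {\<U> j | j. j \<in> \<Lambda>} = components unitaries"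
    and "\<And>j. j \<in> \<Lambda> \<union> {0} \<Longrightarrow> surj_real_linear_isometry (T j)"
    and "\<And>j u. j \<in> \<Lambda> \<union> {0} \<Longrightarrow> u \<in> \<U> j \<Longrightarrow> T j u = \<Delta> u"
  shows "(\<exists>F. surj_real_linear_isometry F \<and> (\<forall>u\<in>unitaries. F u = \<Delta> u)) \<longleftrightarrow>
         (\<forall>j\<^sub>1\<in>\<Lambda> \<union> {0}. \<forall>j\<^sub>2\<in>\<Lambda> \<union> {0}. T j\<^sub>1 = T j\<^sub>2)"
proof
  assume "\<exists>F. surj_real_linear_isometry F \<and> (\<forall>u\<in>unitaries. F u = \<Delta> u)"
  then obtain F where F: "surj_real_linear_isometry F" "\<And>u. u \<in> unitaries \<Longrightarrow> F u = \<Delta> u"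
    by blast
  have "T j = F" if j: "j \<in> \<Lambda> \<union> {0}" for j
  proof
    fix x
    have "\<U> j \<in> components unitaries"
      using assms(5) j by blast
    then obtain u where u: "u \<in> unitaries" "\<U> j = connected_component_set unitaries u"
      by (auto simp: components_def)
    have "bounded_linear (\<lambda>y. T j y - F y)"
      by (intro bounded_linear_sub surj_real_linear_isometry_bounded_linear assms(6) j F(1))
    moreover have "T j w - F w = 0" if "w \<in> connected_component_set unitaries u" for w
    proof -
      have "w \<in> unitaries"
        using that connected_component_subset by blast
      then show ?thesis
        using that assms(7)[OF j, of w] F(2)[of w] u(2) by simp
    qed
    ultimately have "T j x - F x = 0"
      using vanishes_on_component[OF _ u(1)] by blast
    then show "T j x = F x" by simp
  qed
  then show "\<forall>j\<^sub>1\<in>\<Lambda> \<union> {0}. \<forall>j\<^sub>2\<in>\<Lambda> \<union> {0}. T j\<^sub>1 = T j\<^sub>2"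
    by simp
next
  assume T: "\<forall>j\<^sub>1\<in>\<Lambda> \<union> {0}. \<forall>j\<^sub>2\<in>\<Lambda> \<union> {0}. T j\<^sub>1 = T j\<^sub>2"
  \<comment> \<open>The common map \<open>T 0\<close> is the extension, since the components cover
    the unitaries.\<close>
  have "T 0 u = \<Delta> u" if "u \<in> unitaries" for u
  proof -
    have "u \<in> \<Union> (components unitaries)"
      using that by simp
    then obtain j where j: "j \<in> \<Lambda> \<union> {0}" "u \<in> \<U> j"
      unfolding assms(5)[symmetric] by blast
    moreover have "T 0 = T j"
      using T j(1) by blast
    ultimately show ?thesis
      using assms(7) by simp
  qed
  then show "\<exists>F. surj_real_linear_isometry F \<and> (\<forall>u\<in>unitaries. F u = \<Delta> u)"
    using assms(6)[of 0] by blast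
qed

end
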